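(* Let $r \ge 1$, let $\lambda = (\kappa_1^{v_1}, \dotsc, \kappa_m^{v_m}) \in \mathbb{Z}_{\ge 0}^r$ be a partition, and let $\beta \in \mathbb{Z}_{\ge 0}^r$ be a composition such that $\beta \vartriangleleft \lambda$ (that is, $\lambda$ and $\beta$ form a primitive pair). Then the degree of the stretched Kostka coefficient $\mathcal{K}_{\lambda\beta}(n) = K_{n\lambda, n\beta}$, as a polynomial in $n$, is given by $$\deg \mathcal{K}_{\lambda\beta}(n) = \binom{r-1}{2} - \sum_{p=1}^{m} \binom{v_p}{2},$$ where $\binom{1}{2}$ is evaluated as $0$.
   Context: A partition here is a sequence $\lambda = (\lambda_1, \dotsc, \lambda_r) \in \mathbb{Z}_{\ge 0}^r$ with $\lambda_1 \ge \dotsb \ge \lambda_r$ (parts equal to $0$ are allowed and counted). A composition is a sequence $\beta = (\beta_1, \dotsc, \beta_r) \in \mathbb{Z}_{\ge 0}^r$ (zeros allowed), of the same length $r$ as $\lambda$ and with $\sum_i \beta_i = \sum_i \lambda_i$. Write $|\lambda| = \sum_i \lambda_i$ and $|\beta| = \sum_i \beta_i$. The notation $\lambda = (\kappa_1^{v_1}, \dotsc, \kappa_m^{v_m})$ means that $\kappa_1 > \dotsb > \kappa_m$ are the distinct values among the parts of $\lambda$ (including the value $0$ if it occurs) and that $\lambda$ has exactly $v_p \ge 1$ parts equal to $\kappa_p$, for $1 \le p \le m$; thus $\sum_p v_p = r$. Let $\overline{\beta} = (\overline{\beta}_1, \dotsc, \overline{\beta}_r)$ be the unique partition obtained by permuting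 the terms of $\beta$. Write $\beta \vartriangleleft \lambda$, and say that $\lambda$ and $\beta$ form a primitive pair, if $|\lambda| = |\beta|$ and $\sum_{k=1}^{i} \lambda_k > \sum_{k=1}^{i} \overline{\beta}_k$ for all $1 \le i < r$. The Kostka coefficient $K_{\lambda\beta}$ is the number of semi-standard Young tableaux of shape $\lambda$ and content $\beta$; equivalently, it is the dimension of the weight-$\beta$ subspace of the irreducible representation $V_\lambda$ of $\mathfrak{gl}_r(\mathbb{C})$ with highest weight $\lambda$. The stretched Kostka coefficient is the function $\mathcal{K}_{\lambda\beta} : n \mapsto K_{n\lambda, n\beta}$ on positive integers $n$, where $n\lambda = (n\lambda_1, \dotsc, n\lambda_r)$ and $n\beta = (n\beta_1, \dotsc, n\beta_r)$. It is known (Kirillov and Reshetikhin) that this function is given by a polynomial in $n$; $\deg \mathcal{K}_{\lambda\beta}(n)$ denotes the degree of that polynomial. Binomial coefficients $\binom{a}{2}$ mean $a(a-1)/2$ for integers $a \ge 0$, in particular $\binom{0}{2} = \binom{1}{2} = 0$. *)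

theory Defs
  imports Complex_Main "HOL-Computational_Algebra.Polynomial"
begin

text \<open>
  Partitions and compositions are lists of natural numbers. Zero entries are kept,
  so the length \<open>r\<close> of the list is part of the data.
\<close>

definition is_partition :: "nat list \<Rightarrow> bool" where
  "is_partition lam \<longleftrightarrow> sorted_wrt (\<ge>) lam"

text \<open>
  \<open>lam\<close> has the distinct values \<open>\<kappa> 1 > \<dots> > \<kappa> m\<close>, with multiplicities \<open>v 1, \<dots>, v m\<close>.
  The multiplicities are positive because each \<open>\<kappa> p\<close> occurs in \<open>lam\<close>.
\<close>

definition has_blocks :: "nat list \<Rightarrow> nat \<Rightarrow> (nat \<Rightarrow> nat) \<Rightarrow> (nat \<Rightarrow> nat) \<Rightarrow> bool" where
  "has_blocks lam m \<kappa> v \<longleftrightarrow>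
     (\<forall>p\<in>{1..m}. \<forall>q\<in>{1..m}. p < q \<longrightarrow> \<kappa> p > \<kappa> q) \<and>
     set lam = \<kappa> ` {1..m} \<and>
     (\<forall>p\<in>{1..m}. v p = count_list lam (\<kappa> p))"

definition decreasing_rearrangement :: "nat list \<Rightarrow> nat list" where
  "decreasing_rearrangement \<beta> = rev (sort \<beta>)"

definition primitive_pair :: "nat list \<Rightarrow> nat list \<Rightarrow> bool" where
  "primitive_pair lam \<beta> \<longleftrightarrow>
     length \<beta> = length lam \<and>
     sum_list lam = sum_list \<beta> \<and>
     (\<forall>i. 1 \<le> i \<and> i < length lam \<longrightarrow>
        sum_list (take i lam) > sum_list (take i (decreasing_rearrangement \<beta>)))"

text \<open>
  A tableau is the list of its rows, from top to bottom; a part \<open>0\<close> of the shape gives an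
  empty row. The entries are \<open>1, \<dots>, r\<close> with \<open>r = length \<beta>\<close>, whereas list positions start
  at \<open>0\<close>, so the number of entries \<open>k\<close> is prescribed by \<open>\<beta> ! (k - 1)\<close>.
\<close>

definition ssyt :: "nat list \<Rightarrow> nat list \<Rightarrow> nat list list set" where
  "ssyt lam \<beta> = {T.
     map length T = lam \<and>
     (\<forall>row\<in>set T. sorted row) \<and>
     (\<forall>i j. Suc i < length T \<and> j < length (T ! i) \<and> j < length (T ! Suc i)
        \<longrightarrow> T ! i ! j < T ! Suc i ! j) \<and>
     set (concat T) \<subseteq> {1..length \<beta>} \<and>
     (\<forall>k\<in>{1..length \<beta>}. count_list (concat T) k = \<beta> ! (k - 1))}"

definition kostka :: "nat list \<Rightarrow> nat list \<Rightarrow> nat" where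
  "kostka lam \<beta> = card (ssyt lam \<beta>)"

definition stretched_kostka :: "nat list \<Rightarrow> nat list \<Rightarrow> nat \<Rightarrow> nat" where
  "stretched_kostka lam \<beta> n = kostka (map ((*) n) lam) (map ((*) n) \<beta>)"

text \<open>The cardinality in \<open>kostka\<close> is that of a finite set.\<close>

lemma finite_ssyt: "finite (ssyt lam \<beta>)"
proof (rule finite_subset)
  let ?R = "{xs. set xs \<subseteq> {1..length \<beta>} \<and> length xs \<le> sum_list lam}"
  show "ssyt lam \<beta> \<subseteq> {T. set T \<subseteq> ?R \<and> length T \<le> length lam}"
  proof
    fix T assume T: "T \<in> ssyt lam \<beta>"
    then have len: "map length T = lam" and ent: "set (concat T) \<subseteq> {1..length \<beta>}"
      by (auto simp: ssyt_def)
    have "length row \<le> sum_list lam" if "row \<in> set T" for row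
      using that len by (auto intro!: member_le_sum_list)
    moreover have "length T = length lam"
      using len by auto
    ultimately show "T \<in> {T. set T \<subseteq> ?R \<and> length T \<le> length lam}"
      using ent by auto
  qed
  show "finite {T. set T \<subseteq> ?R \<and> length T \<le> length lam}"
    by (intro finite_lists_length_le) auto
qed

text \<open>
  \<open>stretched_kostka_poly lam \<beta> p\<close> says that \<open>p\<close> is the polynomial which gives
  the function \<open>n \<mapsto> K\<^bsub>nlam,n\<beta>\<^esub>\<close> on positive integers. Such a \<open>p\<close> exists by a theorem
  of Kirillov and Reshetikhin, and it is unique.
\<close>

definition stretched_kostka_poly :: "nat list \<Rightarrow> nat list \<Rightarrow> real poly \<Rightarrow> bool" where
  "stretched_kostka_poly lam \<beta> p \<longleftrightarrow>
     (\<forall>n\<ge>1. real (stretched_kostka lam \<beta> n) = poly p (real n))"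

lemma stretched_kostka_poly_unique:
  assumes "stretched_kostka_poly lam \<beta> p" and "stretched_kostka_poly lam \<beta> q"
  shows "p = q"
proof (rule ccontr)
  assume "p \<noteq> q"
  then have "finite {x. poly (p - q) x = 0}"
    by (intro poly_roots_finite) simp
  moreover have "real ` {1..} \<subseteq> {x. poly (p - q) x = 0}"
    using assms by (auto simp: stretched_kostka_poly_def)
  ultimately have "finite (real ` {1..})"
    by (rule finite_subset[rotated])
  then have "finite {1::nat..}"
    by (rule finite_imageD) simp
  then show False
    by (simp add: infinite_Ici)
qed

end

theory Submission
  imports Defs "HOL-Library.FuncSet" "HOL-Library.Multiset"
begin

text \<open>
  \<open>K\<^bsub>n\<lambda>,n\<beta>\<^esub>\<close> counts integral Gelfand--Tsetlin patterns with top row \<open>n\<lambda>\<close> and weight \<open>n\<beta>\<close>. An entry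
  is forced exactly when the interlacing inequalities squeeze it between two equal parts of \<open>\<lambda>\<close>; the
  forced entries below the top row correspond to pairs of equal parts, so there are
  \<open>\<Sum>p. v p choose 2\<close> of them. Each of the \<open>r - 1\<close> rows below the top has a free entry, which the row
  sum determines from the others. This leaves \<open>d = (r - 1 choose 2) - (\<Sum>p. v p choose 2)\<close>
  coordinates, each bounded linearly in \<open>n\<close>, so the count is \<open>O(n^d)\<close>. Conversely, primitivity makes
  \<open>\<beta>\<close> an interior point of the polytope of weights, hence some multiple of \<open>(\<lambda>, \<beta>)\<close> has a pattern for
  which all inequalities at free entries are strict; in its dilations the \<open>d\<close> coordinates can be varied
  independently in ranges of linear size.
\<close>

section \<open>Gelfand-Tsetlin patterns\<close>

definition interlacing :: "nat \<Rightarrow> (nat \<Rightarrow> nat \<Rightarrow> int) \<Rightarrow> bool" where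
  "interlacing r x \<longleftrightarrow>
     (\<forall>i<r. \<forall>j<i. x (Suc i) (Suc j) \<le> x i j \<and> x i j \<le> x (Suc i) j)"

text \<open>
  Row \<open>i\<close> consists of the entries \<open>x i j\<close> with \<open>j < i\<close>, and row \<open>r\<close> is the top row; the zeros outside
  the triangle make a pattern a unique function.
\<close>

definition gt_patterns ::
    "nat \<Rightarrow> (nat \<Rightarrow> int) \<Rightarrow> (nat \<Rightarrow> int) \<Rightarrow> (nat \<Rightarrow> nat \<Rightarrow> int) set" where
  "gt_patterns r l b = {x.
     (\<forall>i j. i \<le> j \<or> r < i \<longrightarrow> x i j = 0) \<and>
     (\<forall>j<r. x r j = l j) \<and>
     interlacing r x \<and>
     (\<forall>i\<le>r. (\<Sum>j<i. x i j) = (\<Sum>k<i. b k))}"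

lemma interlacingD:
  assumes "interlacing r x" "i < r" "j < i"
  shows "x (Suc i) (Suc j) \<le> x i j" "x i j \<le> x (Suc i) j"
  using assms by (auto simp: interlacing_def)

text \<open>Descending induction from the top row: each step down pushes the lower index one place
  to the right. If the two bounds coincide, the entry is forced.\<close>

lemma interlacing_bounds:
  assumes x: "interlacing r x" and top: "\<And>j. j < r \<Longrightarrow> x r j = l j"
    and "i \<le> r" "j < i"
  shows "l (j + (r - i)) \<le> x i j \<and> x i j \<le> l j"
  using assms(3,4)
proof (induction i arbitrary: j rule: inc_induct)
  case base
  then show ?case using top by simp
next
  case (step i)
  have "l (Suc j + (r - Suc i)) \<le> x (Suc i) (Suc j)" "x (Suc i) j \<le> l j"
    using step.IH[of "Suc j"] step.IH[of j] step.prems by auto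
  moreover have "Suc j + (r - Suc i) = j + (r - i)"
    using step.hyps by simp
  ultimately show ?case
    using interlacingD[OF x, of i j] step.hyps step.prems by auto
qed

section \<open>The bijection between semistandard tableaux and patterns\<close>

lemma sorted_nth_le_iff:
  assumes "sorted xs" "c < length xs"
  shows "xs ! c \<le> i \<longleftrightarrow> c < length (filter (\<lambda>y. y \<le> i) xs)"
  using assms
proof (induction xs arbitrary: c)
  case (Cons a xs)
  show ?case
  proof (cases "a \<le> i")
    case True
    then show ?thesis using Cons by (cases c) auto
  next
    case False
    then have "\<forall>y\<in>set (a # xs). \<not> y \<le> i" using Cons.prems by auto
    moreover from this have "filter (\<lambda>y. y \<le> i) (a # xs) = []"
      by (simp only: filter_empty_conv)
    ultimately show ?thesis using Cons.prems(2) nth_mem by (metis length_0_conv less_zeroE)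
  qed
qed simp

lemma length_filter_le_eq_sum_count:
  fixes xs :: "nat list"
  assumes "set xs \<subseteq> {1..}"
  shows "length (filter (\<lambda>y. y \<le> i) xs) = (\<Sum>k<i. count_list xs (Suc k))"
  using assms
proof (induction xs)
  case (Cons a xs)
  have "(\<Sum>k<i. count_list (a # xs) (Suc k))
      = (\<Sum>k<i. count_list xs (Suc k) + (if k = a - 1 then 1 else 0))"
    using Cons.prems by (intro sum.cong) auto
  moreover have "a - 1 < i \<longleftrightarrow> a \<le> i"
    using Cons.prems by auto
  ultimately show ?case
    using Cons by (simp add: sum.distrib del: count_list.simps)
qed simp

lemma length_filter_concat:
  "length (filter P (concat T)) = (\<Sum>j<length T. length (filter P (T ! j)))"
proof -
  have "length (filter P (concat T)) = sum_list (map (\<lambda>row. length (filter P row)) T)"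
    by (induction T) auto
  also have "\<dots> = (\<Sum>j<length T. length (filter P (T ! j)))"
    by (simp add: sum_list_sum_nth atLeast0LessThan)
  finally show ?thesis .
qed

context
  fixes r :: nat and lam \<beta> :: "nat list" and l b :: "nat \<Rightarrow> int"
  assumes len: "length lam = r" "length \<beta> = r"
    and part: "is_partition lam"
    and l_nth: "\<And>j. j < r \<Longrightarrow> l j = int (lam ! j)"
    and b_nth: "\<And>j. j < r \<Longrightarrow> b j = int (\<beta> ! j)"
begin

text \<open>Row \<open>i\<close> of the pattern is the shape occupied by the entries at most
  \<open>i\<close>, so the pattern encodes a growing chain of shapes.\<close>

definition tableau_pattern :: "nat list list \<Rightarrow> nat \<Rightarrow> nat \<Rightarrow> int" where
  "tableau_pattern T i j =
     (if j < i \<and> i \<le> r then int (length (filter (\<lambda>y. y \<le> i) (T ! j))) else 0)"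

text \<open>Cell \<open>c\<close> of row \<open>j\<close> receives the stage at which it enters the
  chain of shapes.\<close>

definition pattern_tableau :: "(nat \<Rightarrow> nat \<Rightarrow> int) \<Rightarrow> nat list list" where
  "pattern_tableau x =
     map (\<lambda>j. map (\<lambda>c. LEAST i. int c < x i j) [0..<lam ! j]) [0..<r]"

lemma lam_antimono: "i \<le> j \<Longrightarrow> j < r \<Longrightarrow> lam ! j \<le> lam ! i"
  using part len unfolding is_partition_def sorted_wrt_iff_nth_less
  by (cases "i = j") auto

context
  fixes T assumes T: "T \<in> ssyt lam \<beta>"
begin

lemma ssyt_length: "length T = r" "j < r \<Longrightarrow> length (T ! j) = lam ! j"
proof -
  have *: "map length T = lam" using T by (simp add: ssyt_def)
  then show "length T = r" using len by auto
  then show "j < r \<Longrightarrow> length (T ! j) = lam ! j"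
    using * nth_map[of j T length] by simp
qed

lemma ssyt_sorted: "j < r \<Longrightarrow> sorted (T ! j)"
  using T ssyt_length(1) by (auto simp: ssyt_def)

lemma ssyt_column: "Suc j < r \<Longrightarrow> c < lam ! Suc j \<Longrightarrow> T ! j ! c < T ! Suc j ! c"
  using T ssyt_length lam_antimono[of j "Suc j"] by (auto simp: ssyt_def)

text \<open>Strict columns raise the minimum by one per row. This is why cutting the pattern off
  outside \<open>j < i\<close> loses nothing.\<close>

lemma ssyt_entry: "j < r \<Longrightarrow> c < lam ! j \<Longrightarrow> T ! j ! c \<in> {Suc j..r}"
proof (induction j)
  have ent: "T ! j ! c \<in> {1..r}" if "j < r" "c < lam ! j" for j
  proof -
    have "T ! j ! c \<in> set (concat T)"
      unfolding set_concat
      by (rule UN_I[of "T ! j"]) (use that ssyt_length in \<open>auto intro: nth_mem\<close>)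
    then show ?thesis using T len by (auto simp: ssyt_def)
  qed
  {
    case 0
    then show ?case using ent[of 0] by simp
  next
    case (Suc j)
    then have "T ! j ! c \<in> {Suc j..r}"
      using lam_antimono[of j "Suc j"] by auto
    then show ?case
      using ssyt_column[of j c] Suc.prems ent[of "Suc j"] by auto
  }
qed

lemma ssyt_filter_iff:
  "j < r \<Longrightarrow> c < length (filter (\<lambda>y. y \<le> i) (T ! j)) \<longleftrightarrow> c < lam ! j \<and> T ! j ! c \<le> i"
  using sorted_nth_le_iff[OF ssyt_sorted, of j c i] ssyt_length(2)[of j]
    length_filter_le[of "\<lambda>y. y \<le> i" "T ! j"] by fastforce

lemma ssyt_filter_empty: "j < r \<Longrightarrow> i \<le> j \<Longrightarrow> length (filter (\<lambda>y. y \<le> i) (T ! j)) = 0"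
  using ssyt_filter_iff[of j 0 i] ssyt_entry[of j 0] by force

text \<open>The diagonal inequality is column strictness: above an entry at most
  \<open>i + 1\<close> sits one at most \<open>i\<close>. The sum of row \<open>i\<close> counts all
  entries at most \<open>i\<close>.\<close>

lemma tableau_pattern_in: "tableau_pattern T \<in> gt_patterns r l b"
proof -
  let ?N = "\<lambda>i j. length (filter (\<lambda>y. y \<le> i) (T ! j))"
  have leI: "m \<le> n" if "\<And>c. c < m \<Longrightarrow> c < n" for m n :: nat
    using that by (metis less_irrefl not_le_imp_less)
  have top: "?N r j = lam ! j" if "j < r" for j
    using ssyt_filter_iff[OF that, of _ r] ssyt_entry[OF that]
    by (intro antisym leI) auto
  have "?N (Suc i) (Suc j) \<le> ?N i j" "?N i j \<le> ?N (Suc i) j" if "i < r" "j < i" for i j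
  proof -
    show "?N (Suc i) (Suc j) \<le> ?N i j"
    proof (rule leI)
      fix c assume "c < ?N (Suc i) (Suc j)"
      then have "c < lam ! Suc j" "T ! Suc j ! c \<le> Suc i"
        using ssyt_filter_iff[of "Suc j" c "Suc i"] that by auto
      then show "c < ?N i j"
        using ssyt_column[of j c] ssyt_filter_iff[of j c i] lam_antimono[of j "Suc j"] that
        by auto
    qed
    show "?N i j \<le> ?N (Suc i) j"
      using ssyt_filter_iff[of j _ i] ssyt_filter_iff[of j _ "Suc i"] that
      by (intro leI) auto
  qed
  then have inter: "interlacing r (tableau_pattern T)"
    by (auto simp: interlacing_def tableau_pattern_def)
  have "(\<Sum>j<i. tableau_pattern T i j) = (\<Sum>k<i. b k)" if i: "i \<le> r" for i
  proof -
    have ent: "set (concat T) \<subseteq> {1..}"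
      and cnt: "\<And>k. k < r \<Longrightarrow> count_list (concat T) (Suc k) = \<beta> ! k"
      using T len by (auto simp: ssyt_def)
    \<comment> \<open>Rows \<open>j \<ge> i\<close> have no entry at most \<open>i\<close>, so the
      sum may run over the whole tableau.\<close>
    have "(\<Sum>j<i. ?N i j) = (\<Sum>j<r. ?N i j)"
      using i ssyt_filter_empty by (intro sum.mono_neutral_left) auto
    also have "\<dots> = length (filter (\<lambda>y. y \<le> i) (concat T))"
      by (simp add: length_filter_concat ssyt_length)
    also have "\<dots> = (\<Sum>k<i. \<beta> ! k)"
      using length_filter_le_eq_sum_count[OF ent] cnt i by simp
    finally have "(\<Sum>j<i. ?N i j) = (\<Sum>k<i. \<beta> ! k)" .
    moreover have "(\<Sum>j<i. tableau_pattern T i j) = int (\<Sum>j<i. ?N i j)"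
      using i by (simp add: tableau_pattern_def)
    ultimately show ?thesis using b_nth i by simp
  qed
  with inter show ?thesis
    using top l_nth by (auto simp: gt_patterns_def tableau_pattern_def)
qed

lemma pattern_tableau_tableau_pattern: "pattern_tableau (tableau_pattern T) = T"
proof (rule nth_equalityI)
  show "length (pattern_tableau (tableau_pattern T)) = length T"
    by (simp add: pattern_tableau_def ssyt_length)
next
  fix j assume "j < length (pattern_tableau (tableau_pattern T))"
  then have j: "j < r" by (simp add: pattern_tableau_def)
  have "(LEAST i. int c < tableau_pattern T i j) = T ! j ! c" if c: "c < lam ! j" for c
  proof (rule Least_equality)
    show "int c < tableau_pattern T (T ! j ! c) j"
      using ssyt_entry[OF j c] ssyt_filter_iff[OF j, of c] c
      by (auto simp: tableau_pattern_def)
  next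
    fix i assume "int c < tableau_pattern T i j"
    then show "T ! j ! c \<le> i"
      using ssyt_filter_iff[OF j, of c i] by (auto simp: tableau_pattern_def split: if_splits)
  qed
  then show "pattern_tableau (tableau_pattern T) ! j = T ! j"
    using j by (intro nth_equalityI) (auto simp: pattern_tableau_def ssyt_length)
qed

end

context
  fixes x assumes x: "x \<in> gt_patterns r l b"
begin

lemma gt_pattern_nonneg: "0 \<le> x i j"
proof (cases "j < i \<and> i \<le> r")
  case True
  then have "l (j + (r - i)) \<le> x i j"
    using interlacing_bounds[of r x l i j] x by (auto simp: gt_patterns_def)
  moreover have "0 \<le> l (j + (r - i))" using True by (subst l_nth) auto
  ultimately show ?thesis by simp
next
  case False
  then show ?thesis using x by (auto simp: gt_patterns_def not_less)
qed

lemma gt_pattern_le: "j < r \<Longrightarrow> i \<le> r \<Longrightarrow> x i j \<le> int (lam ! j)"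
  using interlacing_bounds[of r x l i j] x l_nth[of j]
  by (cases "j < i") (auto simp: gt_patterns_def not_less)

text \<open>Inside the triangle this is interlacing; an entry outside it has the default value 0,
  and the next one is nonnegative.\<close>

lemma gt_pattern_mono: "i \<le> i' \<Longrightarrow> i' \<le> r \<Longrightarrow> x i j \<le> x i' j"
proof (induction i' rule: dec_induct)
  case (step i')
  have "x i' j \<le> x (Suc i') j"
  proof (cases "j < i'")
    case True
    then show ?thesis
      using x step.prems interlacingD(2)[of r x i' j] by (simp add: gt_patterns_def)
  next
    case False
    then have "x i' j = 0" using x by (simp add: gt_patterns_def)
    then show ?thesis using gt_pattern_nonneg by simp
  qed
  then show ?case using step by simp
qed simp

lemma gt_pattern_diagonal: "Suc i \<le> r \<Longrightarrow> x (Suc i) (Suc j) \<le> x i j"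
proof (cases "j < i")
  case True
  then show "Suc i \<le> r \<Longrightarrow> x (Suc i) (Suc j) \<le> x i j"
    using x interlacingD(1)[of r x i j] by (simp add: gt_patterns_def)
next
  case False
  then have "x (Suc i) (Suc j) = 0" "x i j = 0" using x by (auto simp: gt_patterns_def)
  then show ?thesis by simp
qed

text \<open>By monotonicity, the stages up to \<open>r\<close> that contain a given cell are closed
  upwards, and the top row contains every cell of the shape; so the least stage decides
  membership.\<close>

lemma Least_gt_pattern:
  assumes "j < r" "c < lam ! j"
  shows "i \<le> r \<Longrightarrow> (LEAST i. int c < x i j) \<le> i \<longleftrightarrow> int c < x i j"
    and "(LEAST i. int c < x i j) \<in> {1..r}"
    and "int c < x (LEAST i. int c < x i j) j"
proof -
  let ?e = "LEAST i. int c < x i j"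
  have r: "int c < x r j" using x assms l_nth by (auto simp: gt_patterns_def)
  then show e: "int c < x ?e j" by (rule LeastI)
  show "i \<le> r \<Longrightarrow> ?e \<le> i \<longleftrightarrow> int c < x i j"
    using e gt_pattern_mono[of ?e i j] Least_le[of "\<lambda>i. int c < x i j" i] by auto
  have "?e \<noteq> 0"
  proof
    assume "?e = 0"
    moreover have "x 0 j = 0" using x by (simp add: gt_patterns_def)
    ultimately show False using e by simp
  qed
  moreover have "?e \<le> r" using r by (rule Least_le)
  ultimately show "?e \<in> {1..r}" by simp
qed

text \<open>The cells with entry at most \<open>i\<close> are exactly the first \<open>x i j\<close>
  ones. This yields both the content of the tableau and one of the two inverse laws.\<close>

lemma pattern_tableau_filter:
  assumes "j < r" "i \<le> r"
  shows "int (length (filter (\<lambda>y. y \<le> i) (pattern_tableau x ! j))) = x i j"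
proof -
  let ?row = "pattern_tableau x ! j"
  have "{c. c < length ?row \<and> ?row ! c \<le> i} = {..<nat (x i j)}"
    using assms Least_gt_pattern[OF assms(1)] gt_pattern_le[OF assms]
    by (auto simp: pattern_tableau_def)
  then show ?thesis
    using gt_pattern_nonneg[of i j] by (simp add: length_filter_conv_card)
qed

lemma pattern_tableau_in: "pattern_tableau x \<in> ssyt lam \<beta>"
proof -
  let ?T = "pattern_tableau x"
  have lenT: "map length ?T = lam"
    using len by (intro nth_equalityI) (auto simp: pattern_tableau_def)
  have "sorted (?T ! j)" if j: "j < r" for j
    unfolding sorted_iff_nth_mono
  proof (intro allI impI)
    fix c d assume "c \<le> d" "d < length (?T ! j)"
    then have cd: "c \<le> d" "d < lam ! j" using j by (auto simp: pattern_tableau_def)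
    then have "int c < x (LEAST i. int d < x i j) j"
      using Least_gt_pattern(3)[OF j, of d] by linarith
    then have "(LEAST i. int c < x i j) \<le> (LEAST i. int d < x i j)" by (rule Least_le)
    then show "?T ! j ! c \<le> ?T ! j ! d" using j cd by (simp add: pattern_tableau_def)
  qed
  then have sorted: "\<forall>row\<in>set ?T. sorted row"
    by (auto simp: in_set_conv_nth pattern_tableau_def)
  have col: "?T ! j ! c < ?T ! Suc j ! c" if j: "Suc j < r" and c: "c < lam ! Suc j" for j c
  proof -
    let ?e = "LEAST i. int c < x i (Suc j)"
    have c': "c < lam ! j" using c lam_antimono[of j "Suc j"] j by simp
    have e: "?e \<in> {1..r}" "int c < x ?e (Suc j)" using Least_gt_pattern[OF j c] by auto
    then obtain i where i: "?e = Suc i" by (cases ?e) auto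
    \<comment> \<open>The diagonal inequality: a cell present at stage \<open>Suc i\<close> has the
      cell above it present at stage \<open>i\<close> already.\<close>
    then have "int c < x i j" using e gt_pattern_diagonal[of i j] by auto
    then have "(LEAST i. int c < x i j) \<le> i" by (rule Least_le)
    then show ?thesis using i j c c' by (simp add: pattern_tableau_def)
  qed
  have ent: "set (concat ?T) \<subseteq> {1..r}"
    using Least_gt_pattern(2) by (auto simp: pattern_tableau_def)
  have sums: "int (\<Sum>k<i. count_list (concat ?T) (Suc k)) = (\<Sum>k<i. b k)" if i: "i \<le> r" for i
  proof -
    have "(\<Sum>k<i. count_list (concat ?T) (Suc k)) = length (filter (\<lambda>y. y \<le> i) (concat ?T))"
      using ent by (intro length_filter_le_eq_sum_count[symmetric]) auto
    also have "\<dots> = (\<Sum>j<r. length (filter (\<lambda>y. y \<le> i) (?T ! j)))"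
      by (subst length_filter_concat) (simp add: pattern_tableau_def)
    also have "int \<dots> = (\<Sum>j<r. x i j)"
      using pattern_tableau_filter[OF _ i] by simp
    also have "\<dots> = (\<Sum>j<i. x i j)"
      using i x by (intro sum.mono_neutral_right) (auto simp: gt_patterns_def)
    finally show ?thesis using x i by (simp add: gt_patterns_def)
  qed
  have "count_list (concat ?T) (Suc k) = \<beta> ! k" if "k < r" for k
    using sums[of "Suc k"] sums[of k] b_nth[of k] that by simp
  then have "count_list (concat ?T) k = \<beta> ! (k - 1)" if "k \<in> {1..r}" for k
    using that by (cases k) auto
  moreover have "length ?T = r" "\<And>j. j < r \<Longrightarrow> length (?T ! j) = lam ! j"
    by (auto simp: pattern_tableau_def)
  ultimately show ?thesis
    using lenT sorted col ent len unfolding ssyt_def by force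
qed

lemma tableau_pattern_pattern_tableau: "tableau_pattern (pattern_tableau x) = x"
  using pattern_tableau_filter x
  by (intro ext) (auto simp: tableau_pattern_def gt_patterns_def not_less)

end

lemma bij_betw_tableau_pattern: "bij_betw tableau_pattern (ssyt lam \<beta>) (gt_patterns r l b)"
  using tableau_pattern_in pattern_tableau_in pattern_tableau_tableau_pattern
    tableau_pattern_pattern_tableau
  by (intro bij_betwI[where g = pattern_tableau]) auto

lemma kostka_eq_card_gt_patterns: "kostka lam \<beta> = card (gt_patterns r l b)"
  unfolding kostka_def by (rule bij_betw_same_card[OF bij_betw_tableau_pattern])

lemma finite_gt_patterns: "finite (gt_patterns r l b)"
  using bij_betw_finite[OF bij_betw_tableau_pattern] finite_ssyt by blast

end

section \<open>Existence of patterns for dominated weights\<close>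

text \<open>Quantifying over all index sets avoids sorting \<open>b\<close>, whose last term can
  then be split off in an induction. For weakly decreasing \<open>l\<close> this is Rado's
  description of the convex hull of the permutations of \<open>l\<close>.\<close>

definition dominates :: "nat \<Rightarrow> (nat \<Rightarrow> int) \<Rightarrow> (nat \<Rightarrow> int) \<Rightarrow> bool" where
  "dominates r l b \<longleftrightarrow>
     sum b {..<r} = sum l {..<r} \<and> (\<forall>S\<subseteq>{..<r}. sum b S \<le> sum l {..<card S})"

text \<open>
  The row below \<open>l\<close> is obtained by replacing neighbours \<open>l j \<ge> b r \<ge> l (Suc j)\<close> by
  \<open>l j + l (Suc j) - b r\<close>. Each of its initial sums is an initial sum of \<open>l\<close>, or an initial sum
  of \<open>l\<close> with one more term minus \<open>b r\<close>, so dominance is inherited.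
\<close>

lemma dominates_imp_pattern:
  assumes "antimono_on {..<r} l" "dominates r l b"
  shows "\<exists>x. (\<forall>j<r. x r j = l j) \<and> interlacing r x \<and> (\<forall>i\<le>r. (\<Sum>j<i. x i j) = (\<Sum>k<i. b k))"
  using assms
proof (induction r arbitrary: l)
  case 0
  then show ?case by (auto simp: interlacing_def)
next
  case (Suc r)
  have anti: "l j \<le> l i" if "i \<le> j" "j \<le> r" for i j
    using Suc.prems(1) that by (auto simp: monotone_on_def)
  have tot: "sum b {..<Suc r} = sum l {..<Suc r}"
    and dom: "\<And>S. S \<subseteq> {..<Suc r} \<Longrightarrow> sum b S \<le> sum l {..<card S}"
    using Suc.prems(2) by (auto simp: dominates_def)
  show ?case
  proof (cases "r = 0")
    case True
    then show ?thesis
      using tot by (intro exI[of _ "\<lambda>i. l"]) (auto simp: interlacing_def le_Suc_eq)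
  next
    case False
    have "l r \<le> b r" using tot dom[of "{..<r}"] by simp
    moreover have "b r \<le> l 0" using dom[of "{r}"] by simp
    \<comment> \<open>The first descent of \<open>l\<close> to \<open>b r\<close> or below; it
      exists since \<open>b r\<close> lies between the last and the first term.\<close>
    ultimately obtain j where j: "j < r" "b r \<le> l j" "l (Suc j) \<le> b r"
    proof -
      assume lr: "l r \<le> b r" and l0: "b r \<le> l 0"
      define k where "k = (LEAST k. l (Suc k) \<le> b r)"
      have r: "l (Suc (r - 1)) \<le> b r" using lr False by simp
      have k1: "l (Suc k) \<le> b r" unfolding k_def using r by (rule LeastI)
      have "k \<le> r - 1" unfolding k_def using r by (rule Least_le)
      moreover have "b r \<le> l k"
      proof (cases k)
        case (Suc k')
        then show ?thesis
          using not_less_Least[of k' "\<lambda>k. l (Suc k) \<le> b r"] k_def by auto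
      qed (use l0 in simp)
      ultimately show thesis using that[of k] k1 False by simp
    qed
    define u where
      "u i = (if i < j then l i else if i = j then l j + l (Suc j) - b r else l (Suc i))" for i
    have sum_lo: "sum u {..<s} = sum l {..<s}" if "s \<le> j" for s
      using that by (intro sum.cong) (auto simp: u_def)
    have sum_hi: "sum u {..<s} = sum l {..<Suc s} - b r" if "Suc j \<le> s" for s
      using that
    proof (induction s rule: dec_induct)
      case base
      then show ?case using sum_lo[of j] by (simp add: u_def)
    next
      case (step s)
      then show ?case by (simp add: u_def)
    qed
    have inter: "l (Suc i) \<le> u i \<and> u i \<le> l i" if "i < r" for i
      using that j anti[of i "Suc i"] by (auto simp: u_def)
    have "antimono_on {..<r} u"
      unfolding monotone_on_def
    proof safe
      fix i i' assume "i < r" "i' < r" "i \<le> i'"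
      then show "u i' \<le> u i"
        using inter[of i] inter[of i'] anti[of "Suc i" i'] by (cases "i = i'") auto
    qed
    moreover have "dominates r u b"
      unfolding dominates_def
    proof (intro conjI allI impI)
      show "sum b {..<r} = sum u {..<r}" using tot sum_hi[of r] j by simp
    next
      fix S assume S: "S \<subseteq> {..<r}"
      then have fin: "finite S" "r \<notin> S" by (auto intro: finite_subset)
      show "sum b S \<le> sum u {..<card S}"
      proof (cases "card S \<le> j")
        case True
        then show ?thesis using sum_lo dom[of S] S by fastforce
      next
        case False
        \<comment> \<open>Here the initial sum of \<open>u\<close> has one more term of
          \<open>l\<close> and lacks \<open>b r\<close>, so dominance is applied to \<open>S\<close>
          with \<open>r\<close> added.\<close>
        have "insert r S \<subseteq> {..<Suc r}" using S by auto
        from dom[OF this] fin have "b r + sum b S \<le> sum l {..<Suc (card S)}" by simp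
        then show ?thesis using sum_hi[of "card S"] False by simp
      qed
    qed
    ultimately obtain x where top: "\<forall>j<r. x r j = u j" and x: "interlacing r x"
      and sums: "\<forall>i\<le>r. (\<Sum>j<i. x i j) = (\<Sum>k<i. b k)"
      using Suc.IH by blast
    have "interlacing (Suc r) (x(Suc r := l))"
      using x inter top by (auto simp: interlacing_def less_Suc_eq)
    moreover have "\<forall>i\<le>Suc r. (\<Sum>j<i. (x(Suc r := l)) i j) = (\<Sum>k<i. b k)"
      using sums tot by (auto simp: le_Suc_eq)
    moreover have "\<forall>j<Suc r. (x(Suc r := l)) (Suc r) j = l j" by simp
    ultimately show ?thesis by (intro exI[of _ "x(Suc r := l)"] conjI)
  qed
qed

section \<open>Interior patterns\<close>

text \<open>Explicitly the sum of \<open>(s choose k) * l (j + k)\<close> over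
  \<open>k \<le> s\<close>: repeated averaging of neighbours without the factors 1/2.\<close>

fun iterated_sum :: "(nat \<Rightarrow> int) \<Rightarrow> nat \<Rightarrow> nat \<Rightarrow> int" where
  "iterated_sum l 0 j = l j"
| "iterated_sum l (Suc s) j = iterated_sum l s j + iterated_sum l s (Suc j)"

lemma iterated_sum_antimono:
  assumes "antimono l"
  shows "iterated_sum l s (Suc j) \<le> iterated_sum l s j"
proof (induction s arbitrary: j)
  case 0
  then show ?case using assms by (simp add: monotone_def)
next
  case (Suc s)
  show ?case using Suc[of j] Suc[of "Suc j"] by simp
qed

text \<open>The difference is a combination of the drops of \<open>l\<close> from \<open>j\<close>
  to \<open>j + Suc s\<close> with positive binomial weights, so a single drop suffices. In the
  induction, the drop falls into one of two overlapping shorter windows.\<close>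

lemma iterated_sum_strict:
  assumes l: "antimono l"
  shows "l (j + Suc s) < l j \<Longrightarrow> iterated_sum l s (Suc j) < iterated_sum l s j"
proof (induction s arbitrary: j)
  case (Suc s)
  consider "l (j + Suc s) < l j" | "l (Suc j + Suc s) < l (Suc j)"
    using Suc.prems antimonoD[OF l, of "Suc j" "j + Suc s"] by force
  then show ?case
    using Suc.IH[of j] Suc.IH[of "Suc j"] iterated_sum_antimono[OF l, of s j]
      iterated_sum_antimono[OF l, of s "Suc j"]
    by cases auto
qed simp

text \<open>Each row consists of the means of neighbours in the row above; the pattern is scaled by
  \<open>2 ^ r\<close> to be integral, which leaves \<open>2 ^ i\<close> in row
  \<open>i\<close>.\<close>

definition mean_pattern :: "nat \<Rightarrow> (nat \<Rightarrow> int) \<Rightarrow> nat \<Rightarrow> nat \<Rightarrow> int" where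
  "mean_pattern r l i j = 2 ^ i * iterated_sum l (r - i) j"

text \<open>A mean lies between its two terms, strictly if they differ.\<close>

lemma mean_pattern_interlaces:
  assumes l: "antimono l" and "i < r"
  shows "mean_pattern r l (Suc i) (Suc j) \<le> mean_pattern r l i j"
    and "mean_pattern r l i j \<le> mean_pattern r l (Suc i) j"
    and "l (j + (r - i)) < l j \<Longrightarrow> mean_pattern r l (Suc i) (Suc j) < mean_pattern r l i j"
    and "l (j + (r - i)) < l j \<Longrightarrow> mean_pattern r l i j < mean_pattern r l (Suc i) j"
proof -
  obtain s where s: "r - i = Suc s" "r - Suc i = s" using assms(2) by (metis Suc_diff_Suc)
  show "mean_pattern r l (Suc i) (Suc j) \<le> mean_pattern r l i j"
    "mean_pattern r l i j \<le> mean_pattern r l (Suc i) j"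
    using iterated_sum_antimono[OF l, of s j] by (simp_all add: mean_pattern_def s)
  show "mean_pattern r l (Suc i) (Suc j) < mean_pattern r l i j"
    "mean_pattern r l i j < mean_pattern r l (Suc i) j" if "l (j + (r - i)) < l j"
    using iterated_sum_strict[OF l, of j s] that by (simp_all add: mean_pattern_def s)
qed

definition free_cells :: "nat \<Rightarrow> (nat \<Rightarrow> int) \<Rightarrow> (nat \<times> nat) set" where
  "free_cells r l = {(i, j). j < i \<and> i < r \<and> l (j + (r - i)) < l j}"

text \<open>
  A pattern \<open>x\<close> of weight \<open>L b\<close> in the relative interior is the sum of an interior pattern \<open>c\<close>
  and an arbitrary pattern whose weight is a large multiple of \<open>b\<close> minus the weight of \<open>c\<close>. Since
  \<open>b\<close> is strictly dominated by \<open>l\<close>, that weight is still dominated by the corresponding multiple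
  of \<open>l\<close>.
\<close>

lemma ex_interior_pattern:
  assumes l: "antimono l"
    and tot: "sum b {..<r} = sum l {..<r}"
    and dom: "\<And>S. S \<subset> {..<r} \<Longrightarrow> S \<noteq> {} \<Longrightarrow> sum b S < sum l {..<card S}"
  shows "\<exists>L>0. \<exists>x. (\<forall>j<r. x r j = int L * l j) \<and> interlacing r x \<and>
    (\<forall>i\<le>r. (\<Sum>j<i. x i j) = int L * (\<Sum>k<i. b k)) \<and>
    (\<forall>(i, j)\<in>free_cells r l. x (Suc i) (Suc j) < x i j \<and> x i j < x (Suc i) j)"
proof -
  define c where "c = mean_pattern r l"
  define M :: nat where "M = 2 ^ r"
  \<comment> \<open>The weight of \<open>c\<close>: the increments of its row sums.\<close>
  define w where "w k = (\<Sum>j<Suc k. c (Suc k) j) - (\<Sum>j<k. c k j)" for k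
  have w: "(\<Sum>k<i. w k) = (\<Sum>j<i. c i j)" for i
    unfolding w_def by (subst sum_lessThan_telescope) simp
  have c_top: "c r j = int M * l j" for j by (simp add: c_def mean_pattern_def M_def)
  \<comment> \<open>Large enough to outweigh every initial sum of \<open>l\<close> together with
    every partial sum of \<open>w\<close>.\<close>
  define N where "N = nat ((\<Sum>k<r. \<bar>l k\<bar>) + (\<Sum>k<r. \<bar>w k\<bar>))"
  have N: "int N = (\<Sum>k<r. \<bar>l k\<bar>) + (\<Sum>k<r. \<bar>w k\<bar>)"
    unfolding N_def by (simp add: sum_nonneg)
  have M: "1 \<le> int M" by (simp add: M_def)
  \<comment> \<open>Adding \<open>c\<close>, with top row \<open>M\<close> times \<open>l\<close>
    and weight \<open>w\<close>, to a pattern for these data gives the multiple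
    \<open>Suc N * M\<close> of both \<open>l\<close> and \<open>b\<close>.\<close>
  have "dominates r (\<lambda>j. int (N * M) * l j) (\<lambda>k. int (Suc N * M) * b k - w k)"
    unfolding dominates_def
  proof (intro conjI allI impI)
    have "(\<Sum>k<r. w k) = int M * sum l {..<r}"
      by (simp add: w c_top sum_distrib_left)
    then show tot': "(\<Sum>k<r. int (Suc N * M) * b k - w k) = (\<Sum>j<r. int (N * M) * l j)"
      using tot by (simp only: sum_subtractf sum_distrib_left[symmetric]) (simp add: algebra_simps)
    fix S assume S: "S \<subseteq> {..<r}"
    then have fin: "finite S" by (rule finite_subset) simp
    consider "S = {}" | "S = {..<r}" | "S \<noteq> {}" "S \<subset> {..<r}" using S by blast
    then show "(\<Sum>k\<in>S. int (Suc N * M) * b k - w k) \<le> (\<Sum>j<card S. int (N * M) * l j)"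
    proof cases
      case 2
      then show ?thesis using tot' by simp
    next
      case 3
      let ?l = "sum l {..<card S}"
      have card: "card S \<le> r" using S card_mono[of "{..<r}" S] by simp
      have "?l \<le> (\<Sum>k<card S. \<bar>l k\<bar>)" by (rule sum_mono) simp
      also have "\<dots> \<le> (\<Sum>k<r. \<bar>l k\<bar>)" using card by (intro sum_mono2) auto
      finally have l_le: "?l \<le> (\<Sum>k<r. \<bar>l k\<bar>)" .
      have "- sum w S \<le> (\<Sum>k\<in>S. \<bar>w k\<bar>)" by (simp add: sum_negf[symmetric] sum_mono)
      also have "\<dots> \<le> (\<Sum>k<r. \<bar>w k\<bar>)" using S by (intro sum_mono2) auto
      finally have w_le: "- sum w S \<le> (\<Sum>k<r. \<bar>w k\<bar>)" .
      let ?W = "\<Sum>k<r. \<bar>w k\<bar>"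
      have "1 * ?W \<le> int M * ?W" using M by (intro mult_right_mono) (auto simp: sum_nonneg)
      moreover have "int M * (?l + ?W) \<le> int M * int N"
        using l_le N by (intro mult_left_mono) auto
      \<comment> \<open>By integrality strict dominance leaves a gap of at least 1; scaled up, it
        pays for \<open>int M * ?l - sum w S\<close>.\<close>
      moreover have "int (Suc N * M) * sum b S \<le> int (Suc N * M) * (?l - 1)"
        using dom[of S] 3 by (intro mult_left_mono) auto
      ultimately have "int (Suc N * M) * sum b S - sum w S \<le> int (N * M) * ?l"
        using w_le M by (simp add: algebra_simps)
      then show ?thesis by (simp add: sum_subtractf sum_distrib_left)
    qed simp
  qed
  moreover have "antimono_on {..<r} (\<lambda>j. int (N * M) * l j)"
    using l by (auto simp: monotone_on_def mult_left_mono)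
  ultimately obtain y where y_top: "\<forall>j<r. y r j = int (N * M) * l j" and y: "interlacing r y"
    and y_sum: "\<forall>i\<le>r. (\<Sum>j<i. y i j) = (\<Sum>k<i. int (Suc N * M) * b k - w k)"
    using dominates_imp_pattern[of r "\<lambda>j. int (N * M) * l j"] by blast
  define x where "x i j = y i j + c i j" for i j
  have "\<forall>j<r. x r j = int (Suc N * M) * l j"
    using y_top c_top by (simp add: x_def algebra_simps)
  moreover have "interlacing r x"
    unfolding interlacing_def x_def
  proof (intro allI impI conjI)
    fix i j assume "i < r" "j < i"
    then show "y (Suc i) (Suc j) + c (Suc i) (Suc j) \<le> y i j + c i j"
      "y i j + c i j \<le> y (Suc i) j + c (Suc i) j"
      using y mean_pattern_interlaces(1,2)[OF l, of i r j]
      by (simp_all add: interlacing_def c_def add_mono)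
  qed
  moreover have "\<forall>i\<le>r. (\<Sum>j<i. x i j) = int (Suc N * M) * (\<Sum>k<i. b k)"
    using y_sum w by (simp only: x_def sum.distrib sum_subtractf sum_distrib_left) simp
  moreover have "x (Suc i) (Suc j) < x i j \<and> x i j < x (Suc i) j"
    if "(i, j) \<in> free_cells r l" for i j
  proof -
    have ij: "j < i" "i < r" "l (j + (r - i)) < l j" using that by (auto simp: free_cells_def)
    then show ?thesis
      using y mean_pattern_interlaces(3,4)[OF l ij(2,3)]
      by (simp add: interlacing_def x_def c_def add_le_less_mono)
  qed
  moreover have "0 < Suc N * M" by (simp add: M_def)
  ultimately show ?thesis
    by (intro exI[of _ "Suc N * M"] exI[of _ x] conjI) auto
qed

section \<open>Counting free cells\<close>

lemma card_strict_pairs: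
  fixes A :: "'a::linorder set"
  assumes "finite A"
  shows "card {(a, b). a \<in> A \<and> b \<in> A \<and> a < b} = card A choose 2"
  using assms
proof (induction A rule: finite_linorder_max_induct)
  case (insert b A)
  have "{(c, d). c \<in> insert b A \<and> d \<in> insert b A \<and> c < d}
      = {(c, d). c \<in> A \<and> d \<in> A \<and> c < d} \<union> (\<lambda>a. (a, b)) ` A"
    using insert.hyps by (auto dest: less_asym)
  moreover have "finite {(c, d). c \<in> A \<and> d \<in> A \<and> c < d}"
    by (rule finite_subset[of _ "A \<times> A"]) (use insert.hyps in auto)
  moreover have "{(c, d). c \<in> A \<and> d \<in> A \<and> c < d} \<inter> (\<lambda>a. (a, b)) ` A = {}"
    using insert.hyps by auto
  moreover have "card ((\<lambda>a. (a, b)) ` A) = card A"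
    by (intro card_image) (auto simp: inj_on_def)
  moreover have "b \<notin> A" using insert.hyps by auto
  ultimately show ?case
    using insert.hyps insert.IH by (simp add: card_Un_disjoint numeral_2_eq_2)
qed simp

lemma finite_free_cells: "finite (free_cells r l)"
  by (rule finite_subset[of _ "{..<r} \<times> {..<r}"]) (auto simp: free_cells_def)

text \<open>Sending \<open>(i, j)\<close> to the positions of its two bounds, \<open>j\<close> and
  \<open>j + (r - i)\<close>, matches free cells with pairs of unequal parts. The remaining pairs of
  positions are sorted by their common value.\<close>

lemma card_free_cells:
  assumes anti: "antimono_on {..<r} l" and val: "l ` {..<r} = \<kappa> ` P"
    and inj: "inj_on \<kappa> P" and P: "finite P"
    and v: "\<And>p. p \<in> P \<Longrightarrow> v p = card {j. j < r \<and> l j = \<kappa> p}"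
  shows "card (free_cells r l) + (\<Sum>p\<in>P. v p choose 2) = r choose 2"
proof -
  define D where "D = {(a, b). a \<in> {..<r} \<and> b \<in> {..<r} \<and> a < b \<and> l b < l a}"
  define B where "B p = {(a, b). a \<in> {j. j < r \<and> l j = \<kappa> p} \<and>
    b \<in> {j. j < r \<and> l j = \<kappa> p} \<and> a < b}" for p
  have fin: "finite D" "finite (B p)" for p
    by (rule finite_subset[of _ "{..<r} \<times> {..<r}"], force simp: D_def B_def, simp)+
  have "(\<lambda>(i, j). (j, j + (r - i))) ` free_cells r l = D"
  proof (intro equalityI subsetI)
    fix q assume "q \<in> D"
    then obtain a b where "q = (a, b)" "a < b" "b < r" "l b < l a" by (auto simp: D_def)
    then show "q \<in> (\<lambda>(i, j). (j, j + (r - i))) ` free_cells r l"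
      by (intro image_eqI[of _ _ "(r - (b - a), a)"]) (auto simp: free_cells_def)
  qed (auto simp: free_cells_def D_def)
  moreover have "inj_on (\<lambda>(i, j). (j, j + (r - i))) (free_cells r l)"
    by (auto simp: inj_on_def free_cells_def)
  ultimately have "card (free_cells r l) = card D" using card_image by metis
  moreover have "card (\<Union>(B ` P)) = (\<Sum>p\<in>P. v p choose 2)"
  proof -
    have "card (\<Union>(B ` P)) = (\<Sum>p\<in>P. card (B p))"
    proof (intro card_UN_disjoint ballI impI)
      fix p q assume "p \<in> P" "q \<in> P" "p \<noteq> q"
      then have "\<kappa> p \<noteq> \<kappa> q" using inj by (auto simp: inj_on_def)
      then show "B p \<inter> B q = {}" by (auto simp: B_def)
    qed (use P fin in auto)
    also have "\<dots> = (\<Sum>p\<in>P. v p choose 2)"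
      unfolding B_def using v by (intro sum.cong refl) (subst card_strict_pairs, auto)
    finally show ?thesis .
  qed
  moreover have "D \<inter> \<Union>(B ` P) = {}" by (auto simp: D_def B_def)
  moreover have "D \<union> \<Union>(B ` P) = {(a, b). a \<in> {..<r} \<and> b \<in> {..<r} \<and> a < b}"
  proof (intro equalityI subsetI)
    fix q assume "q \<in> {(a, b). a \<in> {..<r} \<and> b \<in> {..<r} \<and> a < b}"
    then obtain a b where q: "q = (a, b)" "a < b" "b < r" by auto
    then have "l b \<le> l a" using anti by (auto simp: monotone_on_def)
    moreover obtain p where "p \<in> P" "l a = \<kappa> p" using val q
      by (metis imageE image_eqI lessThan_iff order.strict_trans)
    ultimately show "q \<in> D \<union> \<Union>(B ` P)" using q by (auto simp: D_def B_def)
  qed (auto simp: D_def B_def)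
  moreover have "card {(a, b). a \<in> {..<r} \<and> b \<in> {..<r} \<and> a < b} = r choose 2"
    by (simp only: card_strict_pairs[OF finite_lessThan] card_lessThan)
  ultimately show ?thesis
    using card_Un_disjoint[of D "\<Union>(B ` P)"] fin P by auto
qed

text \<open>Otherwise \<open>l\<close> is constant on every window from \<open>j\<close> to
  \<open>j + (r - i)\<close> with \<open>j < i\<close>. Chaining these windows makes it constant
  from \<open>0\<close> to \<open>r - 1\<close>.\<close>

lemma ex_free_cell:
  assumes l: "antimono l" and "l (r - 1) < l 0" and i: "0 < i" "i < r"
  shows "\<exists>j. (i, j) \<in> free_cells r l"
proof (rule ccontr)
  assume "\<nexists>j. (i, j) \<in> free_cells r l"
  then have eq: "l j \<le> l (j + (r - i))" if "j < i" for j
    using that i unfolding free_cells_def by force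
  have "l (Suc j) = l j" if "j < i" for j
    using eq[OF that] antimonoD[OF l, of j "Suc j"] antimonoD[OF l, of "Suc j" "j + (r - i)"] i
    by linarith
  then have "l j = l 0" if "j \<le> i" for j
    using that by (induction j) auto
  from this[of "i - 1"] have "l (i - 1) = l 0" by simp
  then show False using eq[of "i - 1"] i assms(2) by simp
qed

section \<open>Dominance from the decreasing rearrangement\<close>

text \<open>Greedy comparison: match the head \<open>y\<close> with itself if it lies in
  \<open>M\<close>, and with any element of \<open>M\<close> otherwise; what is left of
  \<open>M\<close> fits into the tail.\<close>

lemma sum_mset_le_take_sorted:
  fixes M :: "nat multiset"
  assumes "sorted_wrt (\<ge>) ys" "M \<subseteq># mset ys"
  shows "sum_mset M \<le> sum_list (take (size M) ys)"
  using assms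
proof (induction ys arbitrary: M)
  case (Cons y ys)
  show ?case
  proof (cases "M = {#}")
    case False
    obtain z where z: "z \<in># M" "z \<le> y" "M - {#z#} \<subseteq># mset ys"
    proof (cases "y \<in># M")
      case True
      then show ?thesis using Cons.prems(2) that[of y] by (simp add: subset_eq_diff_conv)
    next
      case y: False
      then have sub: "M \<subseteq># mset ys"
        using Cons.prems(2)
        by (metis diff_single_trivial mset.simps(2) subset_eq_diff_conv add_mset_add_single)
      obtain z where "z \<in># M" using False by blast
      then show ?thesis
        using that[of z] sub Cons.prems(1) mset_subset_eqD[OF sub]
          subset_mset.order_trans[OF diff_subset_eq_self sub] by auto
    qed
    then obtain M' where M: "M = add_mset z M'" by (metis insert_DiffM)
    then show ?thesis using Cons.IH[of M'] Cons.prems(1) z by simp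
  qed simp
qed simp

lemma sum_nth_le_decreasing_rearrangement:
  assumes "S \<subseteq> {..<length \<beta>}"
  shows "(\<Sum>k\<in>S. \<beta> ! k) \<le> sum_list (take (card S) (decreasing_rearrangement \<beta>))"
proof -
  define M where "M = image_mset ((!) \<beta>) (mset_set S)"
  have "mset_set S \<subseteq># mset_set {..<length \<beta>}"
    using assms by (simp add: subset_imp_msubset_mset_set)
  then have "M \<subseteq># image_mset ((!) \<beta>) (mset_set {..<length \<beta>})"
    unfolding M_def by (rule image_mset_subseteq_mono)
  also have "\<dots> = mset (decreasing_rearrangement \<beta>)"
    unfolding decreasing_rearrangement_def
    by (simp only: lessThan_atLeast0 mset_upt[symmetric] mset_map[symmetric] map_nth
      mset_rev mset_sort)
  finally have "M \<subseteq># mset (decreasing_rearrangement \<beta>)" .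
  moreover have "sorted_wrt (\<ge>) (decreasing_rearrangement \<beta>)"
    by (simp add: decreasing_rearrangement_def sorted_wrt_rev)
  ultimately have "sum_mset M \<le> sum_list (take (size M) (decreasing_rearrangement \<beta>))"
    by (rule sum_mset_le_take_sorted[rotated])
  then show ?thesis by (simp add: M_def sum_unfold_sum_mset)
qed

section \<open>Polynomial degree from growth\<close>

text \<open>A wrong degree would make the difference between \<open>p\<close> and the comparison
  polynomial have a positive leading coefficient, hence violate a bound for large arguments. Lower
  bounds along multiples of \<open>B\<close> suffice, by substituting \<open>B\<close> times the
  variable.\<close>

lemma degree_eqI_growth:
  fixes p :: "real poly"
  assumes upper: "\<And>n. 1 \<le> n \<Longrightarrow> poly p (real n) \<le> (real n * a + 1) ^ d"
    and lower: "\<And>k. 1 \<le> k \<Longrightarrow> real k ^ d \<le> poly p (real (B * k))"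
    and nonneg: "\<And>n. 1 \<le> n \<Longrightarrow> 0 \<le> poly p (real n)"
  shows "degree p = d"
proof (rule antisym)
  have pos: "\<exists>n\<ge>1. 0 < poly q (real n)" if lc: "0 < lead_coeff q" for q
  proof -
    obtain t where t: "\<forall>x\<ge>t. lead_coeff q \<le> poly q x"
      using poly_pinfty_gt_lc[OF lc] by blast
    obtain n where "max 1 t \<le> real n" using real_arch_simple by blast
    with t lc show ?thesis by (intro exI[of _ n]) force
  qed
  show "degree p \<le> d"
  proof (rule ccontr)
    assume deg: "\<not> degree p \<le> d"
    have "lead_coeff p \<noteq> 0" using deg by auto
    moreover have "\<not> lead_coeff p < 0"
      using pos[of "- p"] nonneg by (auto simp: not_less[symmetric])
    ultimately have lc: "0 < lead_coeff p" by linarith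
    let ?q = "p - [:1, a:] ^ d"
    have "degree ([:1, a:] ^ d) \<le> 1 * d"
      by (rule order_trans[OF degree_power_le]) (simp add: mult.commute)
    then have less: "degree ([:1, a:] ^ d) < degree p" using deg by simp
    then have "degree ?q = degree p"
      using degree_add_eq_left[of "- ([:1, a:] ^ d)" p] by simp
    moreover have "coeff ([:1, a:] ^ d) (degree p) = 0" using less by (rule coeff_eq_0)
    ultimately have "0 < lead_coeff ?q" using lc by simp
    then obtain n where "1 \<le> n" "0 < poly ?q (real n)" using pos by blast
    then show False using upper[of n] by (simp add: poly_power algebra_simps)
  qed
  show "d \<le> degree p"
  proof (rule ccontr)
    assume deg: "\<not> d \<le> degree p"
    let ?p = "pcompose p [:0, real B:]"
    let ?q = "monom 1 d - ?p"
    have "degree ?p \<le> degree p"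
      by (rule order_trans[OF degree_pcompose_le]) simp
    then have less: "degree ?p < degree (monom (1::real) d)" using deg by (simp add: degree_monom_eq)
    then have "degree ?q = d"
      using degree_add_eq_left[of "- ?p" "monom 1 d"] by (simp add: degree_monom_eq)
    moreover have "coeff ?p d = 0" using less by (intro coeff_eq_0) (simp add: degree_monom_eq)
    ultimately have "0 < lead_coeff ?q" by simp
    then obtain n where "1 \<le> n" "0 < poly ?q (real n)" using pos by blast
    then show False using lower[of n] by (simp add: poly_pcompose poly_monom mult.commute)
  qed
qed

section \<open>Upper and lower bounds for the number of patterns\<close>

text \<open>The pivot \<open>c i\<close> marks the free entry that the sum of row \<open>i\<close>
  determines. Row \<open>0\<close> is empty and row \<open>r\<close> is prescribed, so neither has a
  pivot.\<close>

locale pivots =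
  fixes r :: nat and l :: "nat \<Rightarrow> int" and c :: "nat \<Rightarrow> nat"
  assumes antimono: "antimono l"
    and pivot: "0 < i \<Longrightarrow> i < r \<Longrightarrow> (i, c i) \<in> free_cells r l"
begin

definition coordinates :: "(nat \<times> nat) set" where
  "coordinates = free_cells r l - (\<lambda>i. (i, c i)) ` {0<..<r}"

lemma finite_coordinates: "finite coordinates"
  by (simp add: coordinates_def finite_free_cells)

lemma card_coordinates: "card coordinates + (r - 1) = card (free_cells r l)"
proof -
  have sub: "(\<lambda>i. (i, c i)) ` {0<..<r} \<subseteq> free_cells r l" using pivot by auto
  have "card ((\<lambda>i. (i, c i)) ` {0<..<r}) = r - 1"
    by (subst card_image) (auto simp: inj_on_def)
  then show ?thesis
    using sub card_mono[OF finite_free_cells sub]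
    by (simp add: coordinates_def card_Diff_subset finite_subset[OF sub finite_free_cells])
qed

text \<open>A pattern is recovered from its coordinates: the other non-pivot entries are forced by
  coinciding bounds, and then the row sums give the pivots.\<close>

lemma card_gt_patterns_le:
  assumes bounds: "\<And>j. j < r \<Longrightarrow> 0 \<le> l j \<and> l j \<le> l 0"
  shows "card (gt_patterns r l b) \<le> (nat (l 0) + 1) ^ card coordinates"
proof -
  let ?rho = "\<lambda>x. restrict (\<lambda>(i, j). x i j) coordinates"
  have "inj_on ?rho (gt_patterns r l b)"
  proof (intro inj_onI ext)
    fix x y i j
    assume x: "x \<in> gt_patterns r l b" and y: "y \<in> gt_patterns r l b" and xy: "?rho x = ?rho y"
    have off_pivot: "x i j = y i j" if "i < r" "j < i" "j \<noteq> c i" for j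
    proof (cases "(i, j) \<in> free_cells r l")
      case True
      then have "(i, j) \<in> coordinates" using that by (auto simp: coordinates_def)
      then show ?thesis using fun_cong[OF xy, of "(i, j)"] by simp
    next
      case False
      then have "l j \<le> l (j + (r - i))" using that unfolding free_cells_def by force
      moreover have "l (j + (r - i)) \<le> u i j \<and> u i j \<le> l j" if "u \<in> gt_patterns r l b" for u
        using that \<open>i < r\<close> \<open>j < i\<close> by (intro interlacing_bounds[of r u]) (auto simp: gt_patterns_def)
      ultimately show ?thesis using x y by (meson order.antisym order.trans)
    qed
    consider "i \<le> j \<or> r < i" | "i = r" "j < i" | "i < r" "j < i" "j \<noteq> c i" | "i < r" "j < i" "j = c i"
      by linarith
    then show "x i j = y i j"
    proof cases
      case 4
      have "(\<Sum>j<i. x i j) = (\<Sum>j<i. y i j)" using x y 4 by (simp add: gt_patterns_def)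
      moreover have "(\<Sum>j\<in>{..<i} - {c i}. x i j) = (\<Sum>j\<in>{..<i} - {c i}. y i j)"
        using off_pivot 4 by (intro sum.cong) auto
      ultimately show ?thesis
        using 4 by (simp add: sum.remove[of "{..<i}" "c i"])
    qed (use x y off_pivot in \<open>auto simp: gt_patterns_def\<close>)
  qed
  moreover have "?rho ` gt_patterns r l b \<subseteq> coordinates \<rightarrow>\<^sub>E {0..l 0}"
  proof (intro image_subsetI PiE_I)
    fix x q assume x: "x \<in> gt_patterns r l b" and q: "q \<in> coordinates"
    then obtain i j where ij: "q = (i, j)" "j < i" "i < r"
      by (auto simp: coordinates_def free_cells_def)
    then have "l (j + (r - i)) \<le> x i j \<and> x i j \<le> l j"
      using x by (intro interlacing_bounds[of r x]) (auto simp: gt_patterns_def)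
    moreover have "0 \<le> l (j + (r - i))" using bounds ij by simp
    ultimately show "?rho x q \<in> {0..l 0}"
      using bounds[of j] ij q by auto
  qed auto
  ultimately have "card (gt_patterns r l b) \<le> card (coordinates \<rightarrow>\<^sub>E {0..l 0})"
    by (intro card_inj_on_le) (auto simp: finite_coordinates intro!: finite_PiE)
  also have "\<dots> = card {0..l 0} ^ card coordinates"
    by (rule card_funcsetE[OF finite_coordinates])
  also have "\<dots> \<le> (nat (l 0) + 1) ^ card coordinates"
    by (intro power_mono) auto
  finally show ?thesis .
qed

text \<open>
  The coordinates of a large multiple of an interior pattern \<open>x\<close> can be moved independently by
  \<open>0, \<dots>, k\<close>; the pivot of each row absorbs the change of the row sum.
\<close>

lemma card_gt_patterns_ge:
  assumes r: "1 \<le> r"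
    and top: "\<And>j. j < r \<Longrightarrow> x r j = int L * l j" and x: "interlacing r x"
    and sums: "\<And>i. i \<le> r \<Longrightarrow> (\<Sum>j<i. x i j) = int L * (\<Sum>k<i. b k)"
    and strict: "\<And>i j. (i, j) \<in> free_cells r l \<Longrightarrow>
      x (Suc i) (Suc j) < x i j \<and> x i j < x (Suc i) j"
    and fin: "finite (gt_patterns r (\<lambda>j. int (2 * r * L * k) * l j) (\<lambda>j. int (2 * r * L * k) * b j))"
  shows "(k + 1) ^ card coordinates
    \<le> card (gt_patterns r (\<lambda>j. int (2 * r * L * k) * l j) (\<lambda>j. int (2 * r * L * k) * b j))"
    (is "_ \<le> card ?G")
proof -
  let ?P = "coordinates \<rightarrow>\<^sub>E {0..int k}"
  \<comment> \<open>Perturbations will be at most \<open>r * k\<close> in absolute value. Scaling by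
    twice that bound turns a gap of 1 in \<open>x\<close> into room for the perturbations of two
    neighbours.\<close>
  define K where "K = int (2 * r * k)"
  define e where "e f i j = (if (i, j) \<in> coordinates then f (i, j) else 0)"
    for f :: "nat \<times> nat \<Rightarrow> int" and i j
  \<comment> \<open>Since \<open>e f\<close> vanishes at pivots, the pivot receives minus the sum of
    the other changes in its row.\<close>
  define h where "h f i j = e f i j - (if 0 < i \<and> i < r \<and> j = c i then \<Sum>j<i. e f i j else 0)"
    for f i j
  define z where "z f i j = (if j < i \<and> i \<le> r then K * x i j + h f i j else 0)" for f i j
  have e_bounds: "0 \<le> e f i j" "e f i j \<le> int k" if "f \<in> ?P" for f i j
    using PiE_mem[OF that, of "(i, j)"] by (auto simp: e_def)
  have k: "int k \<le> int r * int k" using r by (simp add: mult_le_cancel_right1)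
  have h_bounds: "- (int r * int k) \<le> h f i j" "h f i j \<le> int r * int k" if f: "f \<in> ?P" for f i j
  proof -
    have "(\<Sum>j<i. e f i j) \<le> (\<Sum>j<i. int k)" by (intro sum_mono e_bounds f)
    then have "(\<Sum>j<i. e f i j) \<le> int i * int k" by simp
    moreover have "int i * int k \<le> int r * int k" if "i < r"
      using that by (intro mult_right_mono) auto
    moreover have "0 \<le> (\<Sum>j<i. e f i j)" by (intro sum_nonneg e_bounds f)
    ultimately show "- (int r * int k) \<le> h f i j" "h f i j \<le> int r * int k"
      using e_bounds[OF f, of i j] k by (auto simp: h_def)
  qed
  have h_zero: "h f i j = 0" if "(i, j) \<notin> free_cells r l" for f i j
    using that pivot[of i] by (auto simp: h_def e_def coordinates_def)
  have h_sum: "(\<Sum>j<i. h f i j) = 0" if "i \<le> r" for f i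
  proof (cases "0 < i \<and> i < r")
    case True
    then have "c i < i" using pivot[of i] by (auto simp: free_cells_def)
    then show ?thesis using True by (simp add: h_def sum_subtractf)
  next
    case False
    then have "i = 0 \<or> i = r" using that by auto
    then show ?thesis using h_zero[of i] by (auto simp: free_cells_def intro!: sum.neutral)
  qed
  have "z f \<in> ?G" if f: "f \<in> ?P" for f
  proof -
    have "interlacing r (z f)"
      unfolding interlacing_def
    proof (intro allI impI)
      fix i j assume ij: "i < r" "j < i"
      let ?d1 = "x i j - x (Suc i) (Suc j)" and ?d2 = "x (Suc i) j - x i j"
      have "K * x (Suc i) (Suc j) + h f (Suc i) (Suc j) \<le> K * x i j + h f i j \<and>
        K * x i j + h f i j \<le> K * x (Suc i) j + h f (Suc i) j"
      proof (cases "(i, j) \<in> free_cells r l")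
        case True
        have "K * 1 \<le> K * ?d1" "K * 1 \<le> K * ?d2"
          using strict[OF True] by (intro mult_left_mono; simp add: K_def)+
        then show ?thesis
          using h_bounds[OF f, of i j] h_bounds[OF f, of "Suc i" j]
            h_bounds[OF f, of "Suc i" "Suc j"]
          by (simp add: K_def algebra_simps)
      next
        case False
        \<comment> \<open>The bounds of the two neighbours in the row above come from positions
          within this constant window, so those cells are not free either and no perturbation
          occurs.\<close>
        then have const: "l j \<le> l (j + (r - i))" using ij unfolding free_cells_def by force
        have "l (j + (r - i)) \<le> l (j + (r - Suc i))"
          by (intro antimonoD[OF antimono]) simp
        moreover have "l (Suc j) \<le> l j" by (intro antimonoD[OF antimono]) simp
        moreover have "Suc j + (r - Suc i) = j + (r - i)" using ij by simp
        ultimately have "l j \<le> l (j + (r - Suc i))" "l (Suc j) \<le> l (Suc j + (r - Suc i))"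
          using const by (metis order.trans)+
        then have "(Suc i, j) \<notin> free_cells r l" "(Suc i, Suc j) \<notin> free_cells r l"
          by (auto simp: free_cells_def)
        then have "h f i j = 0" "h f (Suc i) j = 0" "h f (Suc i) (Suc j) = 0"
          using False h_zero by auto
        moreover have "0 \<le> K" by (simp add: K_def)
        ultimately show ?thesis
          using interlacingD[OF x ij] by (simp add: mult_left_mono)
      qed
      then show "z f (Suc i) (Suc j) \<le> z f i j \<and> z f i j \<le> z f (Suc i) j"
        using ij by (simp add: z_def)
    qed
    moreover have "z f r j = int (2 * r * L * k) * l j" if "j < r" for j
      using that top h_zero[of r j] by (simp add: z_def K_def free_cells_def)
    moreover have "(\<Sum>j<i. z f i j) = (\<Sum>j<i. int (2 * r * L * k) * b j)" if "i \<le> r" for i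
    proof -
      have "(\<Sum>j<i. z f i j) = K * (\<Sum>j<i. x i j) + (\<Sum>j<i. h f i j)"
        using that by (simp add: z_def sum.distrib sum_distrib_left)
      then show ?thesis
        using sums h_sum that by (simp add: K_def sum_distrib_left algebra_simps)
    qed
    ultimately show ?thesis by (auto simp: gt_patterns_def z_def)
  qed
  moreover have "inj_on z ?P"
  proof (intro inj_onI PiE_ext)
    fix f g q assume q: "q \<in> coordinates" and zz: "z f = z g"
    obtain i j where ij: "q = (i, j)" "j < i" "i < r" "j \<noteq> c i"
      using q by (cases q) (force simp: coordinates_def free_cells_def)
    have "z u i j = K * x i j + u q" for u
      using ij q by (simp add: z_def h_def e_def)
    then show "f q = g q" using zz by (metis add_left_cancel)
  qed
  ultimately have "card ?P \<le> card ?G"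
    using fin by (intro card_inj_on_le) auto
  then show ?thesis
    by (simp add: card_funcsetE[OF finite_coordinates] nat_add_distrib)
qed

end

section \<open>Application to stretched Kostka coefficients\<close>

lemma stretched_kostka_eq_card_gt_patterns:
  assumes "length lam = r" "length \<beta> = r" "is_partition lam"
    and "\<And>j. j < r \<Longrightarrow> l j = int (lam ! j)" "\<And>j. j < r \<Longrightarrow> b j = int (\<beta> ! j)"
  shows "stretched_kostka lam \<beta> n = card (gt_patterns r (\<lambda>j. int n * l j) (\<lambda>j. int n * b j))"
    and "finite (gt_patterns r (\<lambda>j. int n * l j) (\<lambda>j. int n * b j))"
proof -
  have partition: "is_partition (map ((*) n) lam)"
    using assms(3) by (auto simp: is_partition_def sorted_wrt_iff_nth_less)
  have len: "length (map ((*) n) lam) = r" "length (map ((*) n) \<beta>) = r" using assms by auto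
  have val: "int n * l j = int (map ((*) n) lam ! j)" "int n * b j = int (map ((*) n) \<beta> ! j)"
    if "j < r" for j
    using that assms by auto
  show "stretched_kostka lam \<beta> n = card (gt_patterns r (\<lambda>j. int n * l j) (\<lambda>j. int n * b j))"
    unfolding stretched_kostka_def by (rule kostka_eq_card_gt_patterns[OF len partition val])
  show "finite (gt_patterns r (\<lambda>j. int n * l j) (\<lambda>j. int n * b j))"
    by (rule finite_gt_patterns[OF len partition val])
qed

text \<open>The terms of \<open>\<beta>\<close> at any index set sum to at most its
  \<open>card S\<close> largest terms, to which primitivity applies.\<close>

lemma primitive_pair_dominates:
  assumes "primitive_pair lam \<beta>" "length lam = r"
    and l: "\<And>j. j < r \<Longrightarrow> l j = int (lam ! j)" and b: "\<And>j. j < r \<Longrightarrow> b j = int (\<beta> ! j)"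
  shows "sum b {..<r} = sum l {..<r}"
    and "S \<subset> {..<r} \<Longrightarrow> S \<noteq> {} \<Longrightarrow> sum b S < sum l {..<card S}"
proof -
  have len: "length \<beta> = r" and tot: "sum_list lam = sum_list \<beta>"
    and dom: "\<And>i. 1 \<le> i \<Longrightarrow> i < r \<Longrightarrow>
      sum_list (take i (decreasing_rearrangement \<beta>)) < sum_list (take i lam)"
    using assms(1,2) by (auto simp: primitive_pair_def)
  have sum_l: "sum l {..<i} = int (sum_list (take i lam))" if "i \<le> r" for i
    using that l assms(2) by (simp add: sum_list_sum_nth atLeast0LessThan min_absorb1)
  have "sum b {..<r} = int (sum_list \<beta>)"
    using b len by (simp add: sum_list_sum_nth atLeast0LessThan)
  then show "sum b {..<r} = sum l {..<r}" using sum_l[of r] tot assms(2) by simp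
  assume S: "S \<subset> {..<r}" "S \<noteq> {}"
  then have fin: "finite S" by (auto intro: finite_subset)
  have card: "1 \<le> card S" "card S < r"
    using S fin psubset_card_mono[of "{..<r}" S] by (auto simp: Suc_le_eq card_gt_0_iff)
  have "sum b S = int (\<Sum>k\<in>S. \<beta> ! k)" using S b by (auto intro!: sum.cong)
  also have "\<dots> \<le> int (sum_list (take (card S) (decreasing_rearrangement \<beta>)))"
    unfolding of_nat_le_iff
    using S(1) len by (intro sum_nth_le_decreasing_rearrangement) auto
  also have "\<dots> < sum l {..<card S}" using dom[OF card] sum_l[of "card S"] card by simp
  finally show "sum b S < sum l {..<card S}" .
qed

theorem theorem1p1:
  fixes r m :: nat and lam \<beta> :: "nat list" and \<kappa> v :: "nat \<Rightarrow> nat" and p :: "real poly"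
  assumes "r \<ge> 1"
    and "length lam = r" and "length \<beta> = r"
    and "is_partition lam" and "has_blocks lam m \<kappa> v"
    and "primitive_pair lam \<beta>"
    and "stretched_kostka_poly lam \<beta> p"
  shows "int (degree p) = int ((r - 1) choose 2) - (\<Sum>i=1..m. int (v i choose 2))"
proof -
  \<comment> \<open>Extension by 0 keeps \<open>l\<close> decreasing on all of the natural numbers,
    as the parts are nonnegative.\<close>
  define l where "l j = (if j < r then int (lam ! j) else 0)" for j
  define b where "b j = int (\<beta> ! j)" for j
  have l_nth: "l j = int (lam ! j)" if "j < r" for j using that by (simp add: l_def)
  have anti: "antimono l"
  proof (rule antimonoI)
    fix i j :: nat assume "i \<le> j"
    then show "l j \<le> l i"
      using assms(2,4) by (cases "i = j") (auto simp: is_partition_def sorted_wrt_iff_nth_less l_def)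
  qed
  note dom = primitive_pair_dominates[OF assms(6,2) l_nth b_def]
  have l_drop: "l (r - 1) < l 0" if "2 \<le> r"
  proof -
    define q where "q = r - 1"
    have q: "r = Suc q" "0 < q" using \<open>2 \<le> r\<close> by (auto simp: q_def)
    \<comment> \<open>The first inequality and equality of totals give \<open>l q < b q\<close>; the
      second gives \<open>b q < l 0\<close>.\<close>
    have "sum b {..<q} < sum l {..<card {..<q}}" "sum b {q} < sum l {..<card {q}}"
      by (rule dom(2); use q in force)+
    moreover have "sum b {..<Suc q} = sum l {..<Suc q}" using dom(1) unfolding q(1) .
    ultimately have "l q < l 0" by simp
    then show ?thesis by (simp only: q_def)
  qed
  have "\<exists>j. (i, j) \<in> free_cells r l" if "0 < i" "i < r" for i
    using that by (intro ex_free_cell[OF anti l_drop]) auto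
  then obtain c where "\<And>i. 0 < i \<Longrightarrow> i < r \<Longrightarrow> (i, c i) \<in> free_cells r l"
    by metis
  then interpret pivots r l c by unfold_locales (use anti in auto)
  have "card (free_cells r l) + (\<Sum>i=1..m. v i choose 2) = r choose 2"
  proof (rule card_free_cells[where \<kappa> = "\<lambda>i. int (\<kappa> i)"])
    show "antimono_on {..<r} l" using anti by (auto simp: monotone_on_def)
    have "l ` {..<r} = int ` set lam"
    proof -
      have "set lam = (!) lam ` {..<r}" using assms(2) by (auto simp: set_conv_nth)
      moreover have "l ` {..<r} = (\<lambda>j. int (lam ! j)) ` {..<r}"
        by (intro image_cong refl l_nth) simp
      ultimately show ?thesis by (simp only: image_image)
    qed
    then show "l ` {..<r} = (\<lambda>i. int (\<kappa> i)) ` {1..m}"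
      using assms(5) by (simp add: has_blocks_def image_image)
    show "inj_on (\<lambda>i. int (\<kappa> i)) {1..m}"
    proof (rule linorder_inj_onI)
      fix i j assume "i < j" "i \<in> {1..m}" "j \<in> {1..m}"
      then have "\<kappa> j < \<kappa> i" using assms(5) unfolding has_blocks_def by blast
      then show "int (\<kappa> i) \<noteq> int (\<kappa> j)" by simp
    qed auto
    show "v i = card {j. j < r \<and> l j = int (\<kappa> i)}" if "i \<in> {1..m}" for i
    proof -
      have "v i = count_list lam (\<kappa> i)" using assms(5) that by (auto simp: has_blocks_def)
      also have "\<dots> = card {j. j < r \<and> lam ! j = \<kappa> i}"
        by (simp add: count_list_eq_length_filter length_filter_conv_card assms(2) eq_commute)
      also have "{j. j < r \<and> lam ! j = \<kappa> i} = {j. j < r \<and> l j = int (\<kappa> i)}"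
        using l_nth by auto
      finally show ?thesis .
    qed
  qed simp
  \<comment> \<open>Discarding the \<open>r - 1\<close> pivots lowers the binomial coefficient by
    Pascal's rule.\<close>
  moreover have "r choose 2 = (r - 1 choose 2) + (r - 1)"
    using assms(1) by (cases r) (simp_all add: numeral_2_eq_2)
  ultimately have card_E: "card coordinates + (\<Sum>i=1..m. v i choose 2) = (r - 1) choose 2"
    using card_coordinates by simp
  let ?G = "\<lambda>n. gt_patterns r (\<lambda>j. int n * l j) (\<lambda>j. int n * b j)"
  have K: "poly p (real n) = real (card (?G n))" if "1 \<le> n" for n
    using stretched_kostka_eq_card_gt_patterns(1)[OF assms(2-4) l_nth b_def] assms(7) that
    by (simp add: stretched_kostka_poly_def)
  obtain L x where L: "0 < L" and top: "\<forall>j<r. x r j = int L * l j" and x: "interlacing r x"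
    and sums: "\<forall>i\<le>r. (\<Sum>j<i. x i j) = int L * (\<Sum>k<i. b k)"
    and strict: "\<forall>(i, j)\<in>free_cells r l. x (Suc i) (Suc j) < x i j \<and> x i j < x (Suc i) j"
    using ex_interior_pattern[OF anti dom] by blast
  have "degree p = card coordinates"
  proof (rule degree_eqI_growth)
    fix n :: nat assume n: "1 \<le> n"
    then show "0 \<le> poly p (real n)" using K by simp
    \<comment> \<open>Dilation preserves strict drops, so the same pivots and coordinates serve for
      every \<open>n\<close>.\<close>
    have "free_cells r (\<lambda>j. int n * l j) = free_cells r l" using n by (simp add: free_cells_def)
    then interpret n: pivots r "\<lambda>j. int n * l j" c
      using pivot anti by unfold_locales (auto simp: antimono_def mult_left_mono)
    have "n.coordinates = coordinates"
      using \<open>free_cells r (\<lambda>j. int n * l j) = free_cells r l\<close>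
      by (simp add: coordinates_def n.coordinates_def)
    moreover have "0 \<le> int n * l j \<and> int n * l j \<le> int n * l 0" for j
      using antimonoD[OF anti, of 0 j] by (simp add: l_def mult_left_mono)
    ultimately have "card (?G n) \<le> (nat (int n * l 0) + 1) ^ card coordinates"
      using n.card_gt_patterns_le by metis
    also have "nat (int n * l 0) = n * lam ! 0"
      using l_nth[of 0] assms(1) by (simp add: nat_mult_distrib)
    finally have "real (card (?G n)) \<le> real ((n * lam ! 0 + 1) ^ card coordinates)"
      by (rule of_nat_mono)
    then show "poly p (real n) \<le> (real n * real (lam ! 0) + 1) ^ card coordinates"
      using K[OF n] by (simp add: add.commute)
  next
    fix k :: nat assume k: "1 \<le> k"
    have "(k + 1) ^ card coordinates \<le> card (?G (2 * r * L * k))"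
      using top x sums strict
      by (intro card_gt_patterns_ge[OF assms(1), of x]
          stretched_kostka_eq_card_gt_patterns(2)[OF assms(2-4) l_nth b_def]) auto
    then have "k ^ card coordinates \<le> card (?G (2 * r * L * k))"
      using power_mono[of k "k + 1" "card coordinates"] by simp
    then have "real k ^ card coordinates \<le> real (card (?G (2 * r * L * k)))"
      by (metis of_nat_le_iff of_nat_power)
    then show "real k ^ card coordinates \<le> poly p (real (2 * r * L * k))"
      using K[of "2 * r * L * k"] L k assms(1) by simp
  qed
  then show ?thesis using card_E by (simp flip: of_nat_sum)
qed

end
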